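(* Let $(\mathfrak g,\cdot_{\mathfrak g})$ be a pre-Lie algebra and $N:\mathfrak g\to\mathfrak g$ a linear operator. (i) If $N^2=0$, then $N$ is a Nijenhuis operator if and only if $N$ is a Rota-Baxter operator of weight zero on $\mathfrak g$. (ii) If $N^2=N$, then $N$ is a Nijenhuis operator if and only if $N$ is a Rota-Baxter operator of weight $-1$ on $\mathfrak g$. (iii) If $N^2=\mathrm{Id}$, then $N$ is a Nijenhuis operator if and only if $N\pm\mathrm{Id}$ is a Rota-Baxter operator of weight $\mp2$ on $\mathfrak g$ (for either choice of sign, upper signs together or lower signs together).
   Context: $\mathbb K$ is an algebraically closed field of characteristic $0$; vector spaces are finite dimensional over $\mathbb K$. A pre-Lie algebra is a vector space $\mathfrak g$ with a bilinear product $\cdot_{\mathfrak g}$ such that $(x\cdot_{\mathfrak g} y)\cdot_{\mathfrak g} z-x\cdot_{\mathfrak g}(y\cdot_{\mathfrak g} z)$ is symmetric in $x,y$. A linear map $N:\mathfrak g\to\mathfrak g$ is a Nijenhuis operator if $N(x)\cdot_{\mathfrak g}N(y)=N\big(N(x)\cdot_{\mathfrak g}y+x\cdot_{\mathfrak g}N(y)-N(x\cdot_{\mathfrak g}y)\big)$ for all $x,y$. A linear map $\mathcal R:\mathfrak g\to\mathfrak g$ is a Rota-Baxter operator of weight $\lambda\in\mathbb K$ if $\mathcal R(x)\cdot_{\mathfrak g}\mathcal R(y)=\mathcal R(\mathcal R(x)\cdot_{\mathfrak g}y+x\cdot_{\mathfrak g}\mathcal R(y))+\lambda\mathcal R(x\cdot_{\mathfrak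 g}y)$ for all $x,y$. *)

theory Defs
  imports "HOL-Computational_Algebra.Polynomial"
begin

(* The vector space is the whole type 'v; Basis is an arbitrary finite basis, so that
   finite dimensionality is part of the structure. *)
locale pre_lie_algebra = finite_dimensional_vector_space scale Basis
  for scale :: "'k::field \<Rightarrow> 'v::ab_group_add \<Rightarrow> 'v"
    and Basis :: "'v set" +
  fixes mul :: "'v \<Rightarrow> 'v \<Rightarrow> 'v"
  assumes linear_mul_left: "\<And>y. Vector_Spaces.linear scale scale (\<lambda>x. mul x y)"
    and linear_mul_right: "\<And>x. Vector_Spaces.linear scale scale (\<lambda>y. mul x y)"
    and associator_symmetric:
      "\<And>x y z. mul (mul x y) z - mul x (mul y z) = mul (mul y x) z - mul y (mul x z)"

definition nijenhuis_operator ::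
    "('k::field \<Rightarrow> 'v::ab_group_add \<Rightarrow> 'v) \<Rightarrow> ('v \<Rightarrow> 'v \<Rightarrow> 'v) \<Rightarrow> ('v \<Rightarrow> 'v) \<Rightarrow> bool" where
  "nijenhuis_operator scale mul N \<longleftrightarrow>
     Vector_Spaces.linear scale scale N \<and>
     (\<forall>x y. mul (N x) (N y) = N (mul (N x) y + mul x (N y) - N (mul x y)))"

definition rota_baxter_operator ::
    "('k::field \<Rightarrow> 'v::ab_group_add \<Rightarrow> 'v) \<Rightarrow> ('v \<Rightarrow> 'v \<Rightarrow> 'v) \<Rightarrow> 'k \<Rightarrow> ('v \<Rightarrow> 'v) \<Rightarrow> bool" where
  "rota_baxter_operator scale mul w R \<longleftrightarrow>
     Vector_Spaces.linear scale scale R \<and>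
     (\<forall>x y. mul (R x) (R y) = R (mul (R x) y + mul x (R y)) + scale w (R (mul x y)))"

end

theory Submission
  imports Defs
begin

text \<open>
  Two observations carry the proof. First, for a linear operator \<open>R\<close> with \<open>R\<^sup>2 = -w R\<close>, the
  Nijenhuis identity and the Rota-Baxter identity of weight \<open>w\<close> are the same equation:
  they differ only in the terms \<open>-R (R (x y))\<close> and \<open>w R (x y)\<close>
  (\<open>nijenhuis_iff_rota_baxter\<close>). Second, the Nijenhuis torsion of \<open>N\<close> does not change when a
  multiple of the identity is added to \<open>N\<close> (\<open>nijenhuis_add_scalar_iff\<close>).

  If \<open>N\<^sup>2 = 0\<close> or \<open>N\<^sup>2 = N\<close>, the first observation applies to \<open>N\<close> itself, with \<open>w = 0\<close> or
  \<open>w = -1\<close>. If \<open>N\<^sup>2 = Id\<close>, then \<open>N \<plusminus> Id\<close> annihilates \<open>N \<mp> Id\<close>, so that \<open>R = N \<plusminus> Id\<close>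
  satisfies \<open>R\<^sup>2 = \<plusminus>2 R\<close>. The second observation passes from \<open>N\<close> to \<open>R\<close>, and the
  first one applies to \<open>R\<close> with \<open>w = \<mp>2\<close>.
\<close>

lemma nijenhuis_iff_rota_baxter:
  assumes lin: "Vector_Spaces.linear scale scale R"
    and square: "\<And>x. R (R x) = scale (- w) (R x)"
  shows "nijenhuis_operator scale mul R \<longleftrightarrow> rota_baxter_operator scale mul w R"
proof -
  interpret R: Vector_Spaces.linear scale scale R
    by (fact lin)
  have "R (z - R u) = R z + scale w (R u)" for z u
    by (simp add: R.diff square)
  then show ?thesis
    unfolding nijenhuis_operator_def rota_baxter_operator_def by (simp add: lin)
qed

lemma linear_add_scalar:
  assumes "Vector_Spaces.linear scale scale N"
  shows "Vector_Spaces.linear scale scale (\<lambda>x. N x + scale c x)"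
proof -
  interpret N: Vector_Spaces.linear scale scale N
    by (fact assms)
  show ?thesis
    by unfold_locales
      (simp_all add: N.add N.scale N.vs1.scale_right_distrib algebra_simps)
qed

context pre_lie_algebra
begin

text \<open>
  The scalar \<open>c\<close> adds \<open>c (N x \<cdot> y + x \<cdot> N y) + c\<^sup>2 (x \<cdot> y)\<close> to both sides of the identity. On
  the right, the bracket becomes \<open>N x \<cdot> y + x \<cdot> N y - N (x \<cdot> y) + c (x \<cdot> y)\<close>, and \<open>N + c\<close> maps its
  last two summands to \<open>-N (N (x \<cdot> y)) + c\<^sup>2 (x \<cdot> y)\<close>: the two terms in \<open>c N (x \<cdot> y)\<close> cancel.
\<close>

lemma nijenhuis_add_scalar:
  assumes "nijenhuis_operator scale mul N"
  shows "nijenhuis_operator scale mul (\<lambda>x. N x + scale c x)"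
proof -
  have lin: "Vector_Spaces.linear scale scale N"
    and nij: "mul (N x) (N y) = N (mul (N x) y + mul x (N y) - N (mul x y))" for x y
    using assms by (auto simp: nijenhuis_operator_def)
  interpret N: Vector_Spaces.linear scale scale N
    by (fact lin)
  interpret left: Vector_Spaces.linear scale scale "\<lambda>x. mul x y" for y
    by (fact linear_mul_left)
  interpret right: Vector_Spaces.linear scale scale "\<lambda>y. mul x y" for x
    by (fact linear_mul_right)
  show ?thesis
    unfolding nijenhuis_operator_def
    by (simp add: linear_add_scalar[OF lin] left.add left.scale right.add right.scale
        nij N.add N.diff N.scale scale_right_distrib scale_right_diff_distrib algebra_simps)
qed

lemma nijenhuis_add_scalar_iff:
  "nijenhuis_operator scale mul (\<lambda>x. N x + scale c x) \<longleftrightarrow> nijenhuis_operator scale mul N"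
proof
  assume "nijenhuis_operator scale mul (\<lambda>x. N x + scale c x)"
  from nijenhuis_add_scalar[OF this, of "- c"]
  show "nijenhuis_operator scale mul N"
    by simp
qed (rule nijenhuis_add_scalar)

text \<open>
  If \<open>-c\<close> is a root of the quadratic polynomial that annihilates \<open>N\<close>, then
  \<open>(N + c)\<^sup>2\<close> is a multiple of \<open>N + c\<close>. This is the case \<open>N\<^sup>2 = c\<^sup>2\<close>, whose roots are \<open>c\<close> and \<open>-c\<close>.
\<close>

lemma nijenhuis_iff_rota_baxter_add_scalar:
  assumes lin: "Vector_Spaces.linear scale scale N"
    and square: "\<And>x. N (N x) = scale (c * c) x"
  shows "nijenhuis_operator scale mul N \<longleftrightarrow>
    rota_baxter_operator scale mul (- 2 * c) (\<lambda>x. N x + scale c x)"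
proof -
  interpret N: Vector_Spaces.linear scale scale N
    by (fact lin)
  have double: "scale (2 * a) x = scale a x + scale a x" for a x
    by (simp only: mult_2 scale_left_distrib)
  have "N (N x + scale c x) + scale c (N x + scale c x)
      = scale (- (- 2 * c)) (N x + scale c x)" for x
    by (simp add: N.add N.scale square double scale_right_distrib mult.assoc add_ac)
  from nijenhuis_iff_rota_baxter[OF linear_add_scalar[OF lin] this, of mul]
  show ?thesis
    by (simp add: nijenhuis_add_scalar_iff)
qed

end

theorem proposition5p2:
  fixes scale :: "'k::{alg_closed_field, field_char_0} \<Rightarrow> 'v::ab_group_add \<Rightarrow> 'v"
    and Basis :: "'v set"
    and mul :: "'v \<Rightarrow> 'v \<Rightarrow> 'v"
    and N :: "'v \<Rightarrow> 'v"
  assumes "pre_lie_algebra scale Basis mul"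
    and "Vector_Spaces.linear scale scale N"
  shows "(N \<circ> N = (\<lambda>x. 0) \<longrightarrow>
            (nijenhuis_operator scale mul N \<longleftrightarrow> rota_baxter_operator scale mul 0 N)) \<and>
         (N \<circ> N = N \<longrightarrow>
            (nijenhuis_operator scale mul N \<longleftrightarrow> rota_baxter_operator scale mul (- 1) N)) \<and>
         (N \<circ> N = id \<longrightarrow>
            (nijenhuis_operator scale mul N \<longleftrightarrow>
               rota_baxter_operator scale mul (- 2) (\<lambda>x. N x + x)) \<and>
            (nijenhuis_operator scale mul N \<longleftrightarrow>
               rota_baxter_operator scale mul 2 (\<lambda>x. N x - x)))"
proof -
  interpret pre_lie_algebra scale Basis mul
    by (fact assms(1))
  note lin = assms(2)
  show ?thesis
  proof (intro conjI impI)
    assume "N \<circ> N = (\<lambda>x. 0)"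
    then have "N (N x) = scale (- 0) (N x)" for x
      by (simp add: fun_eq_iff)
    with lin show "nijenhuis_operator scale mul N \<longleftrightarrow> rota_baxter_operator scale mul 0 N"
      by (rule nijenhuis_iff_rota_baxter)
  next
    assume "N \<circ> N = N"
    then have "N (N x) = scale (- (- 1)) (N x)" for x
      by (simp add: fun_eq_iff)
    with lin show "nijenhuis_operator scale mul N \<longleftrightarrow> rota_baxter_operator scale mul (- 1) N"
      by (rule nijenhuis_iff_rota_baxter)
  next
    assume "N \<circ> N = id"
    then have "N (N x) = scale (1 * 1) x" for x
      by (simp add: fun_eq_iff)
    from nijenhuis_iff_rota_baxter_add_scalar[OF lin this]
    show "nijenhuis_operator scale mul N \<longleftrightarrow>
        rota_baxter_operator scale mul (- 2) (\<lambda>x. N x + x)"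
      by simp
  next
    assume "N \<circ> N = id"
    then have "N (N x) = scale (- 1 * - 1) x" for x
      by (simp add: fun_eq_iff)
    from nijenhuis_iff_rota_baxter_add_scalar[OF lin this]
    show "nijenhuis_operator scale mul N \<longleftrightarrow>
        rota_baxter_operator scale mul 2 (\<lambda>x. N x - x)"
      by simp
  qed
qed

end
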